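(* Let $\lambda X$ be a pure type system with specification $(\mathcal S,\mathcal A,\mathcal R)$ satisfying: for all $c$ and $s_1$, if $(c:s_1)\in\mathcal A$ then there are no $s_2,s_3$ with $(s_1,s_2,s_3)\in\mathcal R$. Then the Hilbert-style pure type system with specification $(\mathcal S,\mathcal A,\emptyset)$ is equivalent to $\lambda X$, and it is trivial in that its only theorems are its axioms, i.e. the judgements $\vdash c:s$ with $(c:s)\in\mathcal A$.
   Context: Pure type systems (PTS): variables, constants $\mathcal C$, sorts $\mathcal S\subseteq\mathcal C$, axioms $\mathcal A$ ($c:s$ with $c\in\mathcal C,s\in\mathcal S$), rules $\mathcal R\subseteq\mathcal S^3$; pseudoterms $\mathcal T::=V\mid\mathcal C\mid\Pi V{:}\mathcal T.\mathcal T\mid\lambda V{:}\mathcal T.\mathcal T\mid\mathcal T\mathcal T$; derivable judgements $\Gamma\vdash M:A$ are generated by (axiom) $\vdash c:s$ for $(c:s)\in\mathcal A$; (start) $\Gamma\vdash A:s\Rightarrow\Gamma,x:A\vdash x:A$ ($x$ fresh); (weakening) $\Gamma\vdash M:B$, $\Gamma\vdash A:s\Rightarrow\Gamma,x:A\vdash M:B$ ($x$ fresh); (application) $\Gamma\vdash M:\Pi x{:}A.B$, $\Gamma\vdash N:A\Rightarrow\Gamma\vdash MN:B[x:=N]$; (abstraction) $\Gamma,x:A\vdash M:B$, $\Gamma\vdash(\Pi x{:}A.B):s\Rightarrow\Gamma\vdash(\lambda x{:}A.M):(\Pi x{:}A.B)$; (product) $\Gamma,x:A\vdash B:s_2$,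 $\Gamma\vdash A:s_1$, $(s_1,s_2,s_3)\in\mathcal R\Rightarrow\Gamma\vdash(\Pi x{:}A.B):s_3$; (conversion) $\Gamma\vdash M:A$, $\Gamma\vdash B:s$, $A=_\beta B\Rightarrow\Gamma\vdash M:B$. A theorem is a derivable judgement with empty context. Hilbert-style PTS (HPTS) with specification $(\mathcal S,\mathcal A,\mathcal B)$: same pseudoterms, only empty contexts; derivable judgements generated by the axioms of $\mathcal A$ and of the finite set $\mathcal B$ of axiom schemes, (application) and (conversion) with empty contexts, (type reduction) $\vdash M:A$, $A\to_\beta B\Rightarrow\vdash M:B$, and (subject reduction) $\vdash M:A$, $M\to_\beta N\Rightarrow\vdash N:A$. It is equivalent to the PTS $(\mathcal S,\mathcal A,\mathcal R)$ if for all $M,A$, $\vdash M:A$ is derivable in one iff in the other. *)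

theory Defs
  imports Main
begin

text \<open>
  Pseudoterms modulo \<open>\<alpha>\<close>-equivalence, in de Bruijn notation. The constants are the elements of
  the type \<^typ>\<open>'c\<close>; the sorts form a subset of it. In \<open>Pi A B\<close> and \<open>Lam A M\<close> the index \<open>0\<close>
  is bound in the second argument only.
\<close>

datatype 'c pterm =
    Var nat
  | Cst 'c
  | Pi "'c pterm" "'c pterm"
  | Lam "'c pterm" "'c pterm"
  | App "'c pterm" "'c pterm"

primrec lift :: "'c pterm \<Rightarrow> nat \<Rightarrow> 'c pterm" where
  "lift (Var i) k = (if i < k then Var i else Var (Suc i))"
| "lift (Cst c) k = Cst c"
| "lift (Pi A B) k = Pi (lift A k) (lift B (Suc k))"
| "lift (Lam A M) k = Lam (lift A k) (lift M (Suc k))"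
| "lift (App M N) k = App (lift M k) (lift N k)"

text \<open>
  \<open>subst M N k\<close> replaces the index \<open>k\<close> by \<open>N\<close> and lowers the indices above \<open>k\<close>, so that
  \<open>subst B N 0\<close> is \<open>B[x := N]\<close> for the variable \<open>x\<close> of a binder that is being removed.
\<close>

primrec subst :: "'c pterm \<Rightarrow> 'c pterm \<Rightarrow> nat \<Rightarrow> 'c pterm" where
  "subst (Var i) N k = (if k < i then Var (i - 1) else if i = k then N else Var i)"
| "subst (Cst c) N k = Cst c"
| "subst (Pi A B) N k = Pi (subst A N k) (subst B (lift N 0) (Suc k))"
| "subst (Lam A M) N k = Lam (subst A N k) (subst M (lift N 0) (Suc k))"
| "subst (App M P) N k = App (subst M N k) (subst P N k)"

inductive beta :: "'c pterm \<Rightarrow> 'c pterm \<Rightarrow> bool" (infix "\<rightarrow>\<^sub>\<beta>" 50) where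
  beta: "App (Lam A M) N \<rightarrow>\<^sub>\<beta> subst M N 0"
| Pi1: "A \<rightarrow>\<^sub>\<beta> A' \<Longrightarrow> Pi A B \<rightarrow>\<^sub>\<beta> Pi A' B"
| Pi2: "B \<rightarrow>\<^sub>\<beta> B' \<Longrightarrow> Pi A B \<rightarrow>\<^sub>\<beta> Pi A B'"
| Lam1: "A \<rightarrow>\<^sub>\<beta> A' \<Longrightarrow> Lam A M \<rightarrow>\<^sub>\<beta> Lam A' M"
| Lam2: "M \<rightarrow>\<^sub>\<beta> M' \<Longrightarrow> Lam A M \<rightarrow>\<^sub>\<beta> Lam A M'"
| App1: "M \<rightarrow>\<^sub>\<beta> M' \<Longrightarrow> App M N \<rightarrow>\<^sub>\<beta> App M' N"
| App2: "N \<rightarrow>\<^sub>\<beta> N' \<Longrightarrow> App M N \<rightarrow>\<^sub>\<beta> App M N'"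

abbreviation beta_eq :: "'c pterm \<Rightarrow> 'c pterm \<Rightarrow> bool" (infix "=\<^sub>\<beta>" 50) where
  "M =\<^sub>\<beta> N \<equiv> equivclp beta M N"

definition pts_spec :: "'c set \<Rightarrow> ('c \<times> 'c) set \<Rightarrow> ('c \<times> 'c \<times> 'c) set \<Rightarrow> bool" where
  "pts_spec \<S> \<A> \<R> \<longleftrightarrow> \<A> \<subseteq> UNIV \<times> \<S> \<and> \<R> \<subseteq> \<S> \<times> \<S> \<times> \<S>"

text \<open>
  \<open>pts \<S> \<A> \<R> \<Gamma> M A\<close> is the judgement \<open>\<Gamma> \<turnstile> M : A\<close>. The head of the list \<open>\<Gamma>\<close> is the most recent
  declaration, and each entry lives in the context formed by the entries after it. Extending the
  context shifts all indices, so the declared variable is automatically fresh.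
\<close>

inductive pts ::
  "'c set \<Rightarrow> ('c \<times> 'c) set \<Rightarrow> ('c \<times> 'c \<times> 'c) set \<Rightarrow>
   'c pterm list \<Rightarrow> 'c pterm \<Rightarrow> 'c pterm \<Rightarrow> bool"
  for \<S> :: "'c set" and \<A> :: "('c \<times> 'c) set" and \<R> :: "('c \<times> 'c \<times> 'c) set"
where
  "axiom": "(c, s) \<in> \<A> \<Longrightarrow> pts \<S> \<A> \<R> [] (Cst c) (Cst s)"
| start: "\<lbrakk>pts \<S> \<A> \<R> \<Gamma> A (Cst s); s \<in> \<S>\<rbrakk> \<Longrightarrow> pts \<S> \<A> \<R> (A # \<Gamma>) (Var 0) (lift A 0)"
| weakening: "\<lbrakk>pts \<S> \<A> \<R> \<Gamma> M B; pts \<S> \<A> \<R> \<Gamma> A (Cst s); s \<in> \<S>\<rbrakk> \<Longrightarrow>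
    pts \<S> \<A> \<R> (A # \<Gamma>) (lift M 0) (lift B 0)"
| application: "\<lbrakk>pts \<S> \<A> \<R> \<Gamma> M (Pi A B); pts \<S> \<A> \<R> \<Gamma> N A\<rbrakk> \<Longrightarrow>
    pts \<S> \<A> \<R> \<Gamma> (App M N) (subst B N 0)"
| abstraction: "\<lbrakk>pts \<S> \<A> \<R> (A # \<Gamma>) M B; pts \<S> \<A> \<R> \<Gamma> (Pi A B) (Cst s); s \<in> \<S>\<rbrakk> \<Longrightarrow>
    pts \<S> \<A> \<R> \<Gamma> (Lam A M) (Pi A B)"
| product: "\<lbrakk>pts \<S> \<A> \<R> (A # \<Gamma>) B (Cst s\<^sub>2); pts \<S> \<A> \<R> \<Gamma> A (Cst s\<^sub>1); (s\<^sub>1, s\<^sub>2, s\<^sub>3) \<in> \<R>\<rbrakk> \<Longrightarrow>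
    pts \<S> \<A> \<R> \<Gamma> (Pi A B) (Cst s\<^sub>3)"
| conversion: "\<lbrakk>pts \<S> \<A> \<R> \<Gamma> M A; pts \<S> \<A> \<R> \<Gamma> B (Cst s); s \<in> \<S>; A =\<^sub>\<beta> B\<rbrakk> \<Longrightarrow>
    pts \<S> \<A> \<R> \<Gamma> M B"

text \<open>
  An axiom scheme is represented by the set of its instances, i.e. a set of pairs \<open>(M, A)\<close>
  standing for judgements \<open>\<turnstile> M : A\<close>.
\<close>

type_synonym 'c scheme = "('c pterm \<times> 'c pterm) set"

definition hpts_spec :: "'c set \<Rightarrow> ('c \<times> 'c) set \<Rightarrow> 'c scheme set \<Rightarrow> bool" where
  "hpts_spec \<S> \<A> \<B> \<longleftrightarrow> \<A> \<subseteq> UNIV \<times> \<S> \<and> finite \<B>"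

inductive hpts ::
  "'c set \<Rightarrow> ('c \<times> 'c) set \<Rightarrow> 'c scheme set \<Rightarrow> 'c pterm \<Rightarrow> 'c pterm \<Rightarrow> bool"
  for \<S> :: "'c set" and \<A> :: "('c \<times> 'c) set" and \<B> :: "'c scheme set"
where
  "axiom": "(c, s) \<in> \<A> \<Longrightarrow> hpts \<S> \<A> \<B> (Cst c) (Cst s)"
| scheme: "\<lbrakk>\<sigma> \<in> \<B>; (M, A) \<in> \<sigma>\<rbrakk> \<Longrightarrow> hpts \<S> \<A> \<B> M A"
| application: "\<lbrakk>hpts \<S> \<A> \<B> M (Pi A B); hpts \<S> \<A> \<B> N A\<rbrakk> \<Longrightarrow>
    hpts \<S> \<A> \<B> (App M N) (subst B N 0)"
| conversion: "\<lbrakk>hpts \<S> \<A> \<B> M A; hpts \<S> \<A> \<B> B (Cst s); s \<in> \<S>; A =\<^sub>\<beta> B\<rbrakk> \<Longrightarrow>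
    hpts \<S> \<A> \<B> M B"
| type_reduction: "\<lbrakk>hpts \<S> \<A> \<B> M A; A \<rightarrow>\<^sub>\<beta> B\<rbrakk> \<Longrightarrow> hpts \<S> \<A> \<B> M B"
| subject_reduction: "\<lbrakk>hpts \<S> \<A> \<B> M A; M \<rightarrow>\<^sub>\<beta> N\<rbrakk> \<Longrightarrow> hpts \<S> \<A> \<B> N A"

definition hpts_equiv_pts ::
  "'c set \<Rightarrow> ('c \<times> 'c) set \<Rightarrow> 'c scheme set \<Rightarrow> ('c \<times> 'c \<times> 'c) set \<Rightarrow> bool" where
  "hpts_equiv_pts \<S> \<A> \<B> \<R> \<longleftrightarrow> (\<forall>M A. hpts \<S> \<A> \<B> M A \<longleftrightarrow> pts \<S> \<A> \<R> [] M A)"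

end

theory Submission
  imports Defs
begin

text \<open>
  By induction on derivations, a closed judgement \<open>\<turnstile> M : A\<close> of \<open>\<lambda>X\<close> is an axiom. A product
  \<open>\<Pi>x:A. B\<close> would need \<open>\<turnstile> A : s\<^sub>1\<close> with \<open>(s\<^sub>1, s\<^sub>2, s\<^sub>3) \<in> \<R>\<close>, but then \<open>A : s\<^sub>1\<close> would be an axiom,
  which the assumption excludes; so there are no closed products, hence no closed abstractions
  or applications. A conversion relates two constants, and by confluence of \<open>\<beta>\<close> (shown by
  parallel reduction and complete developments) \<open>\<beta>\<close>-equal constants are identical. The same
  argument applies to the Hilbert-style system, where constants moreover do not reduce.
\<close>

lemma lift_lift: "i < Suc k \<Longrightarrow> lift (lift M i) (Suc k) = lift (lift M k) i"
  by (induction M arbitrary: i k) auto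

lemma lift_subst: "j < Suc i \<Longrightarrow> lift (subst M N j) i = subst (lift M (Suc i)) (lift N i) j"
  by (induction M arbitrary: i j N) (auto simp: lift_lift gr0_conv_Suc)

lemma lift_subst_le: "i < Suc j \<Longrightarrow> lift (subst M N j) i = subst (lift M i) (lift N i) (Suc j)"
  by (induction M arbitrary: i j N) (auto simp: lift_lift)

lemma subst_lift [simp]: "subst (lift M k) N k = M"
  by (induction M arbitrary: k N) auto

text \<open>The substitution lemma in de Bruijn form. With \<open>i = 0\<close> it pushes an outer
  substitution through the contractum of a redex.\<close>

lemma subst_subst:
  "i < Suc j \<Longrightarrow>
    subst (subst M (lift V i) (Suc j)) (subst U V j) i = subst (subst M U i) V j"
  by (induction M arbitrary: i j U V) (auto simp: lift_lift [symmetric] lift_subst_le)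

text \<open>Parallel reduction in the style of Tait and Martin-Loef: any selection of the redexes
  already present is contracted at once.\<close>

inductive par :: "'c pterm \<Rightarrow> 'c pterm \<Rightarrow> bool" (infix "\<Rightarrow>\<^sub>\<beta>" 50) where
  Var: "Var i \<Rightarrow>\<^sub>\<beta> Var i"
| Cst: "Cst c \<Rightarrow>\<^sub>\<beta> Cst c"
| Pi: "\<lbrakk>A \<Rightarrow>\<^sub>\<beta> A'; B \<Rightarrow>\<^sub>\<beta> B'\<rbrakk> \<Longrightarrow> Pi A B \<Rightarrow>\<^sub>\<beta> Pi A' B'"
| Lam: "\<lbrakk>A \<Rightarrow>\<^sub>\<beta> A'; M \<Rightarrow>\<^sub>\<beta> M'\<rbrakk> \<Longrightarrow> Lam A M \<Rightarrow>\<^sub>\<beta> Lam A' M'"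
| App: "\<lbrakk>M \<Rightarrow>\<^sub>\<beta> M'; N \<Rightarrow>\<^sub>\<beta> N'\<rbrakk> \<Longrightarrow> App M N \<Rightarrow>\<^sub>\<beta> App M' N'"
| beta: "\<lbrakk>M \<Rightarrow>\<^sub>\<beta> M'; N \<Rightarrow>\<^sub>\<beta> N'\<rbrakk> \<Longrightarrow> App (Lam A M) N \<Rightarrow>\<^sub>\<beta> subst M' N' 0"

inductive_cases par_CstE: "Cst c \<Rightarrow>\<^sub>\<beta> N"
inductive_cases par_LamE: "Lam A M \<Rightarrow>\<^sub>\<beta> N"

lemma par_refl: "M \<Rightarrow>\<^sub>\<beta> M"
  by (induction M) (auto intro: par.intros)

lemma beta_imp_par: "M \<rightarrow>\<^sub>\<beta> N \<Longrightarrow> M \<Rightarrow>\<^sub>\<beta> N"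
  by (induction rule: beta.induct) (auto intro: par.intros par_refl)

lemma par_lift: "M \<Rightarrow>\<^sub>\<beta> M' \<Longrightarrow> lift M k \<Rightarrow>\<^sub>\<beta> lift M' k"
proof (induction arbitrary: k rule: par.induct)
  case (beta M M' N N' A)
  then show ?case
    by (simp add: lift_subst par.beta)
qed (auto intro: par.intros)

lemma par_subst:
  "M \<Rightarrow>\<^sub>\<beta> M' \<Longrightarrow> N \<Rightarrow>\<^sub>\<beta> N' \<Longrightarrow> subst M N k \<Rightarrow>\<^sub>\<beta> subst M' N' k"
proof (induction arbitrary: N N' k rule: par.induct)
  case (beta M M' P P' A)
  have "App (Lam (subst A N k) (subst M (lift N 0) (Suc k))) (subst P N k)
      \<Rightarrow>\<^sub>\<beta> subst (subst M' (lift N' 0) (Suc k)) (subst P' N' k) 0"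
    using beta by (intro par.beta) (auto intro: par_lift)
  then show ?case
    by (simp add: subst_subst)
qed (simp_all add: par.intros par_lift)

fun complete_development :: "'c pterm \<Rightarrow> 'c pterm" where
  "complete_development (Var i) = Var i"
| "complete_development (Cst c) = Cst c"
| "complete_development (Pi A B) = Pi (complete_development A) (complete_development B)"
| "complete_development (Lam A M) = Lam (complete_development A) (complete_development M)"
| "complete_development (App (Lam A M) N) =
    subst (complete_development M) (complete_development N) 0"
| "complete_development (App M N) = App (complete_development M) (complete_development N)"

text \<open>Takahashi's triangle property: the complete development contracts every redex of
  \<open>M\<close>, so contracting those that a parallel step left over leads there.\<close>

lemma par_complete_development: "M \<Rightarrow>\<^sub>\<beta> N \<Longrightarrow> N \<Rightarrow>\<^sub>\<beta> complete_development M"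
proof (induction rule: par.induct)
  case (App M M' N N')
  show ?case
  \<comment> \<open>If \<open>M\<close> is an abstraction, the application is a redex which this
    step did not contract; \<open>M'\<close> is again an abstraction, so it can be contracted
    now.\<close>
  proof (cases M)
    case (Lam A P)
    with App.hyps obtain A' P' where M': "M' = Lam A' P'"
      by (auto elim: par_LamE)
    with App.IH Lam have "P' \<Rightarrow>\<^sub>\<beta> complete_development P"
      by (auto elim: par_LamE)
    with App.IH Lam M' show ?thesis
      by (auto intro: par.beta)
  qed (use App.IH in \<open>auto intro: par.App\<close>)
qed (auto intro: par.intros par_subst)

text \<open>The part of confluence needed here. If the given reduction begins with a step from
  \<open>M\<close> to \<open>M'\<close>, then \<open>M'\<close> and \<open>N\<close> both step to
  the complete development of \<open>M\<close>, which reaches \<open>Cst c\<close> by the induction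
  hypothesis for \<open>M'\<close>.\<close>

lemma par_rtranclp_Cst:
  assumes "par\<^sup>*\<^sup>* M (Cst c)" and "M \<Rightarrow>\<^sub>\<beta> N"
  shows "par\<^sup>*\<^sup>* N (Cst c)"
  using assms
proof (induction arbitrary: N rule: converse_rtranclp_induct)
  case base
  then show ?case by (auto elim: par_CstE)
next
  case (step M M')
  have "par\<^sup>*\<^sup>* (complete_development M) (Cst c)"
    using step by (blast intro: par_complete_development)
  then show ?case
    using step.prems by (blast intro: par_complete_development converse_rtranclp_into_rtranclp)
qed

text \<open>Reducibility to \<open>Cst c\<close> is preserved along a conversion: a forward step by
  \<open>par_rtranclp_Cst\<close>, a backward step by prepending it.\<close>

lemma beta_eq_Cst_imp_par_rtranclp:
  assumes "Cst c =\<^sub>\<beta> M"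
  shows "par\<^sup>*\<^sup>* M (Cst c)"
  using assms
proof (induction rule: equivclp_induct)
  case base
  then show ?case by simp
next
  case (step M N)
  then show ?case
    by (blast intro: par_rtranclp_Cst beta_imp_par converse_rtranclp_into_rtranclp)
qed

lemma beta_eq_Cst_iff: "Cst c =\<^sub>\<beta> Cst d \<longleftrightarrow> c = d"
proof
  assume "Cst c =\<^sub>\<beta> Cst d"
  then have "par\<^sup>*\<^sup>* (Cst d) (Cst c)"
    by (rule beta_eq_Cst_imp_par_rtranclp)
  moreover have "N = Cst d" if "par\<^sup>*\<^sup>* (Cst d) N" for N
    using that by (induction rule: rtranclp_induct) (auto elim: par_CstE)
  ultimately show "c = d" by auto
qed simp

inductive_cases beta_CstE: "Cst c \<rightarrow>\<^sub>\<beta> N"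

lemma pts_Nil_imp_axiom:
  assumes "pts \<S> \<A> \<R> [] M A"
    and "\<forall>c s\<^sub>1. (c, s\<^sub>1) \<in> \<A> \<longrightarrow> \<not> (\<exists>s\<^sub>2 s\<^sub>3. (s\<^sub>1, s\<^sub>2, s\<^sub>3) \<in> \<R>)"
  shows "\<exists>c s. (c, s) \<in> \<A> \<and> M = Cst c \<and> A = Cst s"
  using assms(1)
\<comment> \<open>With the context fixed to be empty, \<open>start\<close> and
  \<open>weakening\<close> cannot conclude, and premises under a binder yield no induction
  hypothesis; the closed premises suffice.\<close>
proof (induction "[] :: 'a pterm list" M A rule: pts.induct)
  case (product A B s\<^sub>2 s\<^sub>1 s\<^sub>3)
  then show ?case using assms(2) by blast
next
  case (conversion M A B s)
  \<comment> \<open>The induction hypothesis for \<open>B : s\<close> makes the new type a constant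
    too.\<close>
  then show ?case by (auto simp: beta_eq_Cst_iff)
qed auto

lemma hpts_empty_imp_axiom:
  assumes "hpts \<S> \<A> {} M A"
  shows "\<exists>c s. (c, s) \<in> \<A> \<and> M = Cst c \<and> A = Cst s"
  using assms
proof (induction rule: hpts.induct)
  case (conversion M A B s)
  then show ?case by (auto simp: beta_eq_Cst_iff)
qed (auto elim: beta_CstE)

theorem theorem9:
  fixes \<S> :: "'c set" and \<A> :: "('c \<times> 'c) set" and \<R> :: "('c \<times> 'c \<times> 'c) set"
  assumes "pts_spec \<S> \<A> \<R>"
    and "\<forall>c s\<^sub>1. (c, s\<^sub>1) \<in> \<A> \<longrightarrow> \<not> (\<exists>s\<^sub>2 s\<^sub>3. (s\<^sub>1, s\<^sub>2, s\<^sub>3) \<in> \<R>)"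
  shows "hpts_spec \<S> \<A> {} \<and>
    hpts_equiv_pts \<S> \<A> {} \<R> \<and>
    (\<forall>M A. hpts \<S> \<A> {} M A \<longleftrightarrow> (\<exists>c s. (c, s) \<in> \<A> \<and> M = Cst c \<and> A = Cst s))"
proof -
  have hpts_iff: "hpts \<S> \<A> {} M A \<longleftrightarrow> (\<exists>c s. (c, s) \<in> \<A> \<and> M = Cst c \<and> A = Cst s)" for M A
    using hpts_empty_imp_axiom hpts.axiom by metis
  have pts_iff: "pts \<S> \<A> \<R> [] M A \<longleftrightarrow> (\<exists>c s. (c, s) \<in> \<A> \<and> M = Cst c \<and> A = Cst s)" for M A
    using pts_Nil_imp_axiom [OF _ assms(2)] pts.axiom by metis
  show ?thesis
    using assms(1) by (simp add: hpts_spec_def pts_spec_def hpts_equiv_pts_def hpts_iff pts_iff)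
qed

end
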